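(* Let $l \ge 2$ and let $n_1, n_2, \ldots, n_l$ be positive integers. Let $K_{n_1,n_2,\ldots,n_l}$ be the complete multipartite graph with partite sets of sizes $n_1, \ldots, n_l$. Let $h$ be the minimum positive integer $q$ such that at least one of the following holds: (i) there is $i \in \{1,\ldots,l\}$ such that $\frac{n_i}{q+1} > \left\lfloor \frac{n_i}{q} \right\rfloor$; (ii) there are $i, j \in \{1,\ldots,l\}$ with $i \ne j$ such that $q$ divides neither $n_i$ nor $n_j$. Then $$\chi_=^*(K_{n_1,n_2,\ldots,n_l}) = \sum_{i=1}^l \left\lceil \frac{n_i}{h} \right\rceil .$$
   Context: Graphs are finite, undirected, without loops or multiple edges. The complete multipartite graph $K_{n_1,\ldots,n_l}$ has vertex set the disjoint union of sets $N_1,\ldots,N_l$ with $|N_i| = n_i$, two vertices being adjacent if and only if they lie in different sets $N_i$. For a positive integer $k$, write $[k]=\{1,\ldots,k\}$. A proper $k$-coloring of a graph $G$ is a map $f: V(G) \to [k]$ with $f(x) \neq f(y)$ whenever $xy \in E(G)$; its color classes are the sets $f^{-1}(i)$, $i \in [k]$ (a color class may be empty). An equitable $k$-coloring of $G$ is a proper $k$-coloring in which any two color classes differ in size by at most one, equivalently each of the $k$ color classes has size $\lfloor |V(G)|/k \rfloor$ or $\lceil |V(G)|/k \rceil$; $G$ is equitably $k$-colorable if it has an equitable $k$-coloring. The equitable chromatic threshold $\chi_=^*(G)$ is the minimum positive integer $t$ such that $G$ is equitably $k$-colorable for every integer $k \ge t$. *)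

theory Defs
  imports Complex_Main "HOL-Library.FuncSet"
begin

record 'v graph =
  verts :: "'v set"
  edges :: "'v set set"

text \<open>Undirected edges are two-element sets of vertices, so loops and multiple edges are excluded.\<close>

definition simple_graph :: "'v graph \<Rightarrow> bool" where
  "simple_graph G \<longleftrightarrow>
     finite (verts G) \<and> (\<forall>e \<in> edges G. e \<subseteq> verts G \<and> card e = 2)"

text \<open>
  The parts are realised as the disjoint union of the sets \<open>{i} \<times> {1..n i}\<close>,
  for \<open>i\<close> from \<open>1\<close> to \<open>l\<close>; values of \<open>n\<close> outside this range are irrelevant.
\<close>

definition complete_multipartite :: "nat \<Rightarrow> (nat \<Rightarrow> nat) \<Rightarrow> (nat \<times> nat) graph" where
  "complete_multipartite l n =
     (let V = (SIGMA i:{1..l}. {1..n i})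
      in \<lparr>verts = V, edges = {{x, y} |x y. x \<in> V \<and> y \<in> V \<and> fst x \<noteq> fst y}\<rparr>)"

text \<open>Only the values of a coloring on the vertices matter.\<close>

definition proper_coloring :: "'v graph \<Rightarrow> nat \<Rightarrow> ('v \<Rightarrow> nat) \<Rightarrow> bool" where
  "proper_coloring G k f \<longleftrightarrow>
     f \<in> verts G \<rightarrow> {1..k} \<and> (\<forall>x y. {x, y} \<in> edges G \<longrightarrow> f x \<noteq> f y)"

definition color_class :: "'v graph \<Rightarrow> ('v \<Rightarrow> nat) \<Rightarrow> nat \<Rightarrow> 'v set" where
  "color_class G f i = {x \<in> verts G. f x = i}"

text \<open>
  Both orders of \<open>i\<close> and \<open>j\<close> are covered by the quantifiers, so the inequality
  bounds the absolute difference of the class sizes. Color classes may be empty.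
\<close>

definition equitable_coloring :: "'v graph \<Rightarrow> nat \<Rightarrow> ('v \<Rightarrow> nat) \<Rightarrow> bool" where
  "equitable_coloring G k f \<longleftrightarrow>
     proper_coloring G k f \<and>
     (\<forall>i \<in> {1..k}. \<forall>j \<in> {1..k}. card (color_class G f i) \<le> card (color_class G f j) + 1)"

definition equitably_colorable :: "'v graph \<Rightarrow> nat \<Rightarrow> bool" where
  "equitably_colorable G k \<longleftrightarrow> (\<exists>f. equitable_coloring G k f)"

definition equitable_chromatic_threshold :: "'v graph \<Rightarrow> nat" where
  "equitable_chromatic_threshold G =
     (LEAST t. t > 0 \<and> (\<forall>k \<ge> t. equitably_colorable G k))"

lemma simple_graph_complete_multipartite: "simple_graph (complete_multipartite l n)"
  by (fastforce simp: simple_graph_def complete_multipartite_def Let_def card_2_iff)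

lemma equitably_colorable_if_card_le:
  assumes G: "simple_graph G" and k: "card (verts G) \<le> k"
  shows "equitably_colorable G k"
proof -
  have fin: "finite (verts G)" using G by (simp add: simple_graph_def)
  obtain f where f: "inj_on f (verts G)" "f ` verts G \<subseteq> {1..k}"
    using card_le_inj[of "verts G" "{1..k}"] fin k by auto
  have le1: "card (color_class G f i) \<le> 1" for i
    using f(1) fin by (auto simp: color_class_def card_le_Suc0_iff_eq inj_on_def)
  have "f x \<noteq> f y" if e: "{x, y} \<in> edges G" for x y
  proof -
    have "{x, y} \<subseteq> verts G" "card {x, y} = 2"
      using G e unfolding simple_graph_def by blast+
    then have "x \<in> verts G" "y \<in> verts G" "x \<noteq> y" by auto
    then show ?thesis using f(1) by (auto simp: inj_on_def)
  qed
  then have "proper_coloring G k f"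
    using f(2) by (auto simp: proper_coloring_def)
  moreover have "card (color_class G f i) \<le> card (color_class G f j) + 1" for i j
    using le1[of i] by linarith
  ultimately show ?thesis
    by (auto simp: equitably_colorable_def equitable_coloring_def)
qed

lemma equitable_chromatic_threshold_attained:
  assumes "simple_graph G"
  shows "equitable_chromatic_threshold G > 0 \<and>
    (\<forall>k \<ge> equitable_chromatic_threshold G. equitably_colorable G k)"
  unfolding equitable_chromatic_threshold_def
proof (rule LeastI)
  show "Suc (card (verts G)) > 0 \<and> (\<forall>k \<ge> Suc (card (verts G)). equitably_colorable G k)"
    using assms by (auto intro: equitably_colorable_if_card_le)
qed

end

theory Submission
  imports Defs
begin

text \<open>
  In a proper coloring of a complete multipartite graph every color class lies inside a single
  part. So an equitable \<open>k\<close>-coloring whose smallest class has size \<open>q\<close> amounts to numbers \<open>c i\<close>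
  (the number of colors spent on part \<open>i\<close>) with sum \<open>k\<close> and \<open>q * c i \<le> n i \<le> (q + 1) * c i\<close>; this is
  \<open>equitably_colorable_iff_balanced_split\<close>. For a fixed \<open>q > 0\<close> the admissible values of \<open>c i\<close> are
  those from \<open>\<lceil>n i / (q + 1)\<rceil>\<close> to \<open>\<lfloor>n i / q\<rfloor>\<close>. If none of these ranges is empty, then \<open>q\<close>
  serves exactly the \<open>k\<close> in the interval from \<open>\<Sum>\<lceil>n i / (q + 1)\<rceil>\<close> to \<open>\<Sum>\<lfloor>n i / q\<rfloor>\<close>, and
  otherwise it serves no \<open>k\<close> at all. The value \<open>q = 0\<close> serves all \<open>k \<ge> \<Sum>n i\<close>.

  The two conditions that define \<open>h\<close> say how this chain of intervals can break as \<open>q\<close> grows and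
  \<open>k\<close> decreases: (i) says that the interval of \<open>q\<close> is empty because of some part, and (ii) that two
  floors lie strictly below the corresponding ceilings, so that there is a gap between the intervals
  of \<open>q\<close> and of \<open>q - 1\<close>. For \<open>q < h\<close> neither happens, whence \<open>\<Sum>\<lceil>n i / q\<rceil> \<le> \<Sum>\<lfloor>n i / q\<rfloor> + 1\<close>
  and consecutive intervals leave no gap: every \<open>k \<ge> \<Sum>\<lceil>n i / h\<rceil>\<close> is reached
  (\<open>balanced_split_from_unobstructed\<close>). Conversely \<open>k = \<Sum>\<lceil>n i / h\<rceil> - 1\<close> is not reached
  (\<open>not_balanced_split_below_obstructed\<close>): a \<open>q < h\<close> needs at least \<open>\<Sum>\<lceil>n i / h\<rceil>\<close> colors, while
  for \<open>q \<ge> h\<close> at least two parts have to fall short of \<open>\<lceil>n i / h\<rceil>\<close>.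
\<close>

section \<open>Division rounded up\<close>

definition ceil_div :: "nat \<Rightarrow> nat \<Rightarrow> nat" where
  "ceil_div m q = (m + q - 1) div q"

lemma ceil_div_le_iff: "q > 0 \<Longrightarrow> ceil_div m q \<le> a \<longleftrightarrow> m \<le> q * a"
proof -
  assume q: "q > 0"
  have "ceil_div m q \<le> a \<longleftrightarrow> (m + q - 1) div q < Suc a"
    by (simp add: ceil_div_def less_Suc_eq_le)
  also have "\<dots> \<longleftrightarrow> m + q - 1 < Suc a * q"
    using q by (simp add: div_less_iff_less_mult)
  also have "\<dots> \<longleftrightarrow> m \<le> q * a"
    using q by (auto simp: algebra_simps)
  finally show ?thesis .
qed

lemma ceil_div_1 [simp]: "ceil_div m (Suc 0) = m"
  by (simp add: ceil_div_def)

lemma div_le_ceil_div: "m div q \<le> ceil_div m q"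
  unfolding ceil_div_def by (cases "q = 0") (auto intro: div_le_mono)

lemma ceil_div_eq_div: "q > 0 \<Longrightarrow> q dvd m \<Longrightarrow> ceil_div m q = m div q"
  by (rule antisym) (simp_all add: ceil_div_le_iff div_le_ceil_div)

lemma ceil_div_eq_Suc_div:
  assumes "q > 0" "\<not> q dvd m"
  shows "ceil_div m q = Suc (m div q)"
proof (rule antisym)
  have "m < q * Suc (m div q)"
    using assms(1) by (metis dividend_less_times_div mult_Suc_right add.commute)
  then show "ceil_div m q \<le> Suc (m div q)"
    using assms(1) by (simp add: ceil_div_le_iff)
  have "\<not> m \<le> q * (m div q)"
    using assms(2) by (metis dvd_triv_left le_antisym times_div_less_eq_dividend)
  then show "Suc (m div q) \<le> ceil_div m q"
    using ceil_div_le_iff[OF assms(1), of m "m div q"] by simp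
qed

lemma ceil_div_antimono: "0 < p \<Longrightarrow> p \<le> q \<Longrightarrow> ceil_div m q \<le> ceil_div m p"
  using ceil_div_le_iff[of q m "ceil_div m p"] ceil_div_le_iff[of p m "ceil_div m p"]
    order_trans[OF _ mult_le_mono1[of p q "ceil_div m p"]] by simp

lemma ceiling_divide_eq_ceil_div:
  assumes "q > 0"
  shows "\<lceil>real m / real q\<rceil> = int (ceil_div m q)"
proof (rule ceiling_unique)
  let ?a = "ceil_div m q"
  have "m \<le> q * ?a"
    using ceil_div_le_iff[OF assms, of m ?a] by simp
  then have "real m \<le> real q * real ?a"
    by (metis of_nat_le_iff of_nat_mult)
  then show "real m / real q \<le> of_int (int ?a)"
    using assms by (simp add: field_simps)
  show "of_int (int ?a) - 1 < real m / real q"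
  proof (cases ?a)
    case 0
    then show ?thesis using assms by (simp add: less_le_trans[of _ 0])
  next
    case (Suc b)
    then have "q * b < m"
      using ceil_div_le_iff[OF assms, of m b] by simp
    then have "real q * real b < real m"
      by (metis of_nat_less_iff of_nat_mult)
    then show ?thesis using Suc assms by (simp add: field_simps)
  qed
qed

lemma floor_less_divide_Suc_iff:
  "of_int \<lfloor>real m / real q\<rfloor> < real m / (real q + 1) \<longleftrightarrow> m div q < ceil_div m (Suc q)"
proof -
  have "m div q < ceil_div m (Suc q) \<longleftrightarrow> Suc q * (m div q) < m"
    using ceil_div_le_iff[of "Suc q" m "m div q"] by (simp add: not_le[symmetric])
  also have "\<dots> \<longleftrightarrow> real (Suc q) * real (m div q) < real m"
    by (metis of_nat_less_iff of_nat_mult)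
  also have "\<dots> \<longleftrightarrow> of_int \<lfloor>real m / real q\<rfloor> < real m / (real q + 1)"
    by (simp add: floor_divide_of_nat_eq field_simps)
  finally show ?thesis by simp
qed

section \<open>Balanced splits\<close>

text \<open>
  The numerical content of an equitable coloring with \<open>k\<close> colors: \<open>c i\<close> colors go to part \<open>i\<close>, and all
  classes have size \<open>q\<close> or \<open>q + 1\<close>. The case \<open>q = 0\<close> allows empty classes, each of which
  is charged to an arbitrary part.
\<close>

definition balanced_split :: "'i set \<Rightarrow> ('i \<Rightarrow> nat) \<Rightarrow> nat \<Rightarrow> bool" where
  "balanced_split I n k \<longleftrightarrow>
     (\<exists>q c. (\<forall>i\<in>I. q * c i \<le> n i \<and> n i \<le> Suc q * c i) \<and> sum c I = k)"

lemma ex_sum_between: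
  fixes lo hi :: "'i \<Rightarrow> nat"
  assumes "finite I" "\<And>i. i \<in> I \<Longrightarrow> lo i \<le> hi i" "sum lo I \<le> k" "k \<le> sum hi I"
  shows "\<exists>c. (\<forall>i\<in>I. lo i \<le> c i \<and> c i \<le> hi i) \<and> sum c I = k"
  using assms
proof (induction I arbitrary: k rule: finite_induct)
  case empty
  then show ?case by simp
next
  case (insert x I)
  \<comment> \<open>The new index takes all that the lower bounds of the others leave over, up to its own bound.\<close>
  define a where "a = min (hi x) (k - sum lo I)"
  have sums: "lo x + sum lo I \<le> k" "k \<le> hi x + sum hi I"
    using insert.prems insert.hyps by simp_all
  have le: "sum lo I \<le> sum hi I"
    using insert.prems by (intro sum_mono) auto
  have a: "lo x \<le> a" "a \<le> hi x" "a \<le> k" "sum lo I \<le> k - a" "k - a \<le> sum hi I"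
    using sums le insert.prems(1)[of x] by (auto simp: a_def min_def)
  obtain c where c: "\<forall>i\<in>I. lo i \<le> c i \<and> c i \<le> hi i" "sum c I = k - a"
    using insert.IH[of "k - a"] insert.prems(1) a by auto
  have "sum (c(x := a)) I = sum c I"
    using insert.hyps by (intro sum.cong) auto
  then have "sum (c(x := a)) (insert x I) = k"
    using insert.hyps c a by simp
  then show ?case
    using c a by (intro exI[of _ "c(x := a)"]) auto
qed

text \<open>
  The conditions (i) and (ii) of the theorem, free of real numbers and with an arbitrary index set.
\<close>

definition obstructed :: "'i set \<Rightarrow> ('i \<Rightarrow> nat) \<Rightarrow> nat \<Rightarrow> bool" where
  "obstructed I n q \<longleftrightarrow>
     (\<exists>i\<in>I. n i div q < ceil_div (n i) (Suc q)) \<or>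
     (\<exists>i\<in>I. \<exists>j\<in>I. i \<noteq> j \<and> \<not> q dvd n i \<and> \<not> q dvd n j)"

lemma obstructed_Suc_size:
  assumes "i \<in> I" "n i > 0"
  shows "obstructed I n (Suc (n i))"
proof -
  have "\<not> ceil_div (n i) (Suc (Suc (n i))) \<le> 0"
    using assms(2) by (subst ceil_div_le_iff) auto
  then show ?thesis
    using assms(1) unfolding obstructed_def by (intro disjI1 bexI[of _ i]) auto
qed

text \<open>
  At most one part contributes a difference between ceiling and floor, and that difference is one.
  Hence the interval of \<open>q\<close> reaches up to the beginning of the interval of \<open>q - 1\<close>.
\<close>

lemma sum_ceil_div_le_Suc_sum_div:
  assumes "finite I" "q > 0" "\<not> obstructed I n q"
  shows "(\<Sum>i\<in>I. ceil_div (n i) q) \<le> Suc (\<Sum>i\<in>I. n i div q)"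
proof (cases "\<exists>j\<in>I. \<not> q dvd n j")
  case False
  then have "(\<Sum>i\<in>I. ceil_div (n i) q) = (\<Sum>i\<in>I. n i div q)"
    using assms by (intro sum.cong) (auto simp: ceil_div_eq_div)
  then show ?thesis by simp
next
  case True
  then obtain j where j: "j \<in> I" "\<not> q dvd n j" by blast
  then have "\<forall>i\<in>I - {j}. q dvd n i"
    using assms(3) by (auto simp: obstructed_def)
  then have "(\<Sum>i\<in>I - {j}. ceil_div (n i) q) = (\<Sum>i\<in>I - {j}. n i div q)"
    using assms by (intro sum.cong) (auto simp: ceil_div_eq_div)
  then show ?thesis
    using j assms by (simp add: sum.remove[of I j] ceil_div_eq_Suc_div)
qed

text \<open>
  The intervals of \<open>q = h - 1, \<dots>, 1, 0\<close> together cover everything from the lower end of the first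
  one onwards.
\<close>

lemma balanced_split_from_unobstructed:
  assumes I: "finite I" "I \<noteq> {}" and h: "h > 0"
    and "\<And>q. 0 < q \<Longrightarrow> q < h \<Longrightarrow> \<not> obstructed I n q"
    and "(\<Sum>i\<in>I. ceil_div (n i) h) \<le> k"
  shows "balanced_split I n k"
  using h assms(4,5)
proof (induction h rule: nat_induct_non_zero)
  case 1
  then have "sum n I \<le> k" by simp
  moreover have "n i \<le> k" if "i \<in> I" for i
    using member_le_sum[of i I n] that I \<open>sum n I \<le> k\<close> by auto
  moreover have "k \<le> (\<Sum>i\<in>I. k)"
    using I by (simp add: Suc_le_eq card_gt_0_iff)
  ultimately obtain c where "\<forall>i\<in>I. n i \<le> c i \<and> c i \<le> k" "sum c I = k"
    using ex_sum_between[of I n "\<lambda>_. k" k] I by auto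
  then show ?case
    unfolding balanced_split_def by (intro exI[of _ 0] exI[of _ c]) auto
next
  case (Suc q)
  show ?case
  proof (cases "(\<Sum>i\<in>I. ceil_div (n i) q) \<le> k")
    case True
    then show ?thesis using Suc by simp
  next
    case False
    have q: "\<not> obstructed I n q"
      using Suc.prems(1) Suc.hyps by simp
    then have "k \<le> (\<Sum>i\<in>I. n i div q)"
      using sum_ceil_div_le_Suc_sum_div[OF I(1) Suc.hyps q] False by simp
    moreover have "ceil_div (n i) (Suc q) \<le> n i div q" if "i \<in> I" for i
      using q that by (auto simp: obstructed_def not_less)
    ultimately obtain c where
      c: "\<forall>i\<in>I. ceil_div (n i) (Suc q) \<le> c i \<and> c i \<le> n i div q" "sum c I = k"
      using ex_sum_between[of I "\<lambda>i. ceil_div (n i) (Suc q)" "\<lambda>i. n i div q" k] I Suc.prems by auto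
    have "q * c i \<le> n i \<and> n i \<le> Suc q * c i" if "i \<in> I" for i
      using c(1) that Suc.hyps ceil_div_le_iff[of "Suc q" "n i" "c i"]
      by (auto simp: less_eq_div_iff_mult_less_eq mult.commute)
    then show ?thesis
      using c(2) unfolding balanced_split_def by (intro exI[of _ q] exI[of _ c]) simp
  qed
qed

lemma sum_add_2_le:
  fixes f g :: "'i \<Rightarrow> nat"
  assumes "finite I" "i \<in> I" "j \<in> I" "i \<noteq> j" "f i < g i" "f j < g j"
    and "\<And>x. x \<in> I \<Longrightarrow> f x \<le> g x"
  shows "sum f I + 2 \<le> sum g I"
proof -
  have "sum f (I - {i} - {j}) \<le> sum g (I - {i} - {j})"
    using assms(7) by (intro sum_mono) auto
  then show ?thesis
    using assms(1-6) by (simp add: sum.remove[of I i] sum.remove[of "I - {i}" j])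
qed

text \<open>
  For class sizes \<open>q \<ge> h\<close>, every part uses at most \<open>\<lceil>n i / h\<rceil>\<close> colors, and two parts use fewer. Under
  (ii) these are the two parts whose sizes \<open>h\<close> does not divide. Under (i) without (ii), one of them is
  the part \<open>i\<close> of (i), because \<open>h\<close> does not divide \<open>n i\<close>. Moreover (i) excludes \<open>q = h\<close>, so that \<open>q > h\<close>
  and any other part \<open>j\<close> has \<open>c j \<le> n j / q < n j / h\<close>.
\<close>

lemma not_balanced_split_below_obstructed:
  assumes I: "finite I" "card I \<ge> 2" and pos: "\<And>i. i \<in> I \<Longrightarrow> n i > 0"
    and h: "h > 0" "obstructed I n h"
    and k: "Suc k = (\<Sum>i\<in>I. ceil_div (n i) h)"
  shows "\<not> balanced_split I n k"
proof
  assume "balanced_split I n k"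
  then obtain q c where c: "\<And>i. i \<in> I \<Longrightarrow> q * c i \<le> n i" "\<And>i. i \<in> I \<Longrightarrow> n i \<le> Suc q * c i"
    and sum_c: "sum c I = k"
    unfolding balanced_split_def by blast
  have lower: "ceil_div (n i) (Suc q) \<le> c i" if "i \<in> I" for i
    using c(2)[OF that] ceil_div_le_iff[of "Suc q"] by simp
  have "h \<le> q"
  proof (rule ccontr)
    assume "\<not> h \<le> q"
    then have "ceil_div (n i) h \<le> c i" if "i \<in> I" for i
      using ceil_div_antimono[of "Suc q" h "n i"] lower[OF that] by simp
    then have "(\<Sum>i\<in>I. ceil_div (n i) h) \<le> sum c I"
      by (rule sum_mono)
    then show False using k sum_c by simp
  qed
  have upper: "c i \<le> n i div h" if "i \<in> I" for i
  proof -
    have "c i * h \<le> n i"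
      using order_trans[OF mult_le_mono1[OF \<open>h \<le> q\<close>] c(1)[OF that]] by (simp add: mult.commute)
    then show ?thesis using h by (simp add: less_eq_div_iff_mult_less_eq)
  qed
  have le: "c i \<le> ceil_div (n i) h" if "i \<in> I" for i
    using upper[OF that] div_le_ceil_div le_trans by blast
  have less: "c i < ceil_div (n i) h" if "i \<in> I" "\<not> h dvd n i" for i
    using upper[OF that(1)] ceil_div_eq_Suc_div[OF h(1) that(2)] by simp
  have "\<exists>i\<in>I. \<exists>j\<in>I. i \<noteq> j \<and> c i < ceil_div (n i) h \<and> c j < ceil_div (n j) h"
  proof (cases "\<exists>i\<in>I. \<exists>j\<in>I. i \<noteq> j \<and> \<not> h dvd n i \<and> \<not> h dvd n j")
    case True
    then show ?thesis using less by blast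
  next
    case False
    then obtain i where i: "i \<in> I" "n i div h < ceil_div (n i) (Suc h)"
      using h(2) by (auto simp: obstructed_def)
    have "\<not> h dvd n i"
      using i(2) ceil_div_eq_div[OF h(1)] ceil_div_antimono[OF h(1), of "Suc h" "n i"] by auto
    have "q \<noteq> h"
      using lower[OF i(1)] upper[OF i(1)] i(2) by auto
    have "I \<noteq> {i}" using I(2) by auto
    then obtain j where j: "j \<in> I" "j \<noteq> i" using i(1) by blast
    then have "h dvd n j" using False i(1) \<open>\<not> h dvd n i\<close> by blast
    have "h * c j < n j"
    proof (cases "c j = 0")
      case False
      then have "h * c j < q * c j" using \<open>h \<le> q\<close> \<open>q \<noteq> h\<close> by simp
      also have "\<dots> \<le> n j" using c(1)[OF j(1)] .
      finally show ?thesis .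
    qed (use pos j in simp)
    then have "c j < ceil_div (n j) h"
      using ceil_div_le_iff[OF h(1), of "n j" "c j"] by simp
    then show ?thesis using less[OF i(1) \<open>\<not> h dvd n i\<close>] i(1) j by blast
  qed
  then obtain i j where "i \<in> I" "j \<in> I" "i \<noteq> j"
      "c i < ceil_div (n i) h" "c j < ceil_div (n j) h" by blast
  then have "sum c I + 2 \<le> (\<Sum>i\<in>I. ceil_div (n i) h)"
    using le by (rule sum_add_2_le[OF I(1)])
  then show False using k sum_c by simp
qed

section \<open>Colorings of complete multipartite graphs\<close>

text \<open>
  Within a part the adjacency imposes nothing, so only this counting condition decides whether it can
  be cut into a given number of classes of sizes \<open>q\<close> and \<open>q + 1\<close>.
\<close>

lemma ex_map_balanced_fibres:
  assumes "finite C" "finite A" "q * card C \<le> card A" "card A \<le> Suc q * card C"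
  shows "\<exists>f. f \<in> A \<rightarrow> C \<and> (\<forall>y\<in>C. card {x \<in> A. f x = y} \<in> {q, Suc q})"
  using assms
proof (induction C arbitrary: A rule: finite_induct)
  case empty
  then show ?case by auto
next
  case (insert y C)
  \<comment> \<open>The color \<open>y\<close> gets \<open>q\<close> points unless that leaves too many for the other colors.\<close>
  define m where "m = (if card A \<le> q + Suc q * card C then q else Suc q)"
  have m: "m \<in> {q, Suc q}" "m \<le> card A" "q * card C \<le> card A - m"
    "card A - m \<le> Suc q * card C"
    using insert.prems insert.hyps by (auto simp: m_def)
  obtain B where B: "B \<subseteq> A" "card B = m"
    using obtain_subset_with_card_n[OF m(2)] by blast
  have card_diff: "card (A - B) = card A - m"
    using B insert.prems(1) by (simp add: card_Diff_subset finite_subset)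
  obtain f where f: "f \<in> A - B \<rightarrow> C" "\<forall>z\<in>C. card {x \<in> A - B. f x = z} \<in> {q, Suc q}"
    using insert.IH[of "A - B"] insert.prems(1) m card_diff by auto
  define g where "g x = (if x \<in> B then y else f x)" for x
  have "{x \<in> A. g x = y} = B"
    using B f(1) insert.hyps by (auto simp: g_def)
  moreover have "{x \<in> A. g x = z} = {x \<in> A - B. f x = z}" if "z \<in> C" for z
    using that insert.hyps by (auto simp: g_def)
  moreover have "g \<in> A \<rightarrow> insert y C"
    using f(1) by (auto simp: g_def Pi_iff)
  ultimately show ?case
    using f(2) B(2) m(1) by (intro exI[of _ g]) auto
qed

lemma verts_complete_multipartite:
  "verts (complete_multipartite l n) = (SIGMA i:{1..l}. {1..n i})"
  by (simp add: complete_multipartite_def)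

lemma edge_complete_multipartite_iff:
  "{x, y} \<in> edges (complete_multipartite l n) \<longleftrightarrow>
     x \<in> verts (complete_multipartite l n) \<and> y \<in> verts (complete_multipartite l n) \<and> fst x \<noteq> fst y"
  unfolding complete_multipartite_def Let_def graph.simps
  by (simp only: mem_Collect_eq doubleton_eq_iff) metis

text \<open>
  Two vertices of the same color lie in the same part. So each color can be charged to one part, and
  the classes charged to part \<open>i\<close> partition it. With \<open>q\<close> the smallest class size, every class has size
  \<open>q\<close> or \<open>q + 1\<close>, and summing over the classes in part \<open>i\<close> gives the bounds on \<open>n i\<close>.
\<close>

lemma balanced_split_if_equitably_colorable:
  assumes "l > 0" "k > 0" "equitably_colorable (complete_multipartite l n) k"
  shows "balanced_split {1..l} n k"
proof -
  define G where "G = complete_multipartite l n"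
  obtain f where f: "proper_coloring G k f"
    and eq: "\<And>i j. i \<in> {1..k} \<Longrightarrow> j \<in> {1..k} \<Longrightarrow>
      card (color_class G f i) \<le> card (color_class G f j) + 1"
    using assms(3) unfolding equitably_colorable_def equitable_coloring_def G_def by blast
  have same_part: "fst x = fst y" if "x \<in> verts G" "y \<in> verts G" "f x = f y" for x y
  proof (rule ccontr)
    assume "fst x \<noteq> fst y"
    then have "{x, y} \<in> edges G"
      using that by (simp add: G_def edge_complete_multipartite_iff)
    then show False
      using f that(3) unfolding proper_coloring_def by blast
  qed
  have "\<forall>j. \<exists>i. i \<in> {1..l} \<and> (\<forall>x\<in>color_class G f j. fst x = i)"
  proof
    fix j
    show "\<exists>i. i \<in> {1..l} \<and> (\<forall>x\<in>color_class G f j. fst x = i)"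
    proof (cases "color_class G f j = {}")
      case True
      \<comment> \<open>Empty classes only need some part to be counted in; take the first.\<close>
      then show ?thesis using assms(1) by (intro exI[of _ 1]) auto
    next
      case False
      then obtain x where x: "x \<in> verts G" "f x = j" by (auto simp: color_class_def)
      then have "fst x \<in> {1..l}" by (auto simp: G_def verts_complete_multipartite)
      moreover have "fst y = fst x" if "y \<in> color_class G f j" for y
        using that x by (intro same_part) (simp_all add: color_class_def)
      ultimately show ?thesis by blast
    qed
  qed
  from choice[OF this] obtain p where p: "\<And>j. p j \<in> {1..l}"
    "\<And>j x. x \<in> color_class G f j \<Longrightarrow> fst x = p j"
    by blast
  define J where "J i = {j \<in> {1..k}. p j = i}" for i
  define q where "q = Min ((\<lambda>j. card (color_class G f j)) ` {1..k})"
  have q_in: "q \<in> (\<lambda>j. card (color_class G f j)) ` {1..k}"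
    unfolding q_def using assms(2) by (intro Min_in) auto
  have q: "q \<le> card (color_class G f j)" "card (color_class G f j) \<le> Suc q"
    if "j \<in> {1..k}" for j
  proof -
    show "q \<le> card (color_class G f j)"
      unfolding q_def using that by (intro Min_le) auto
    obtain j' where "j' \<in> {1..k}" "q = card (color_class G f j')"
      using q_in by blast
    then show "card (color_class G f j) \<le> Suc q"
      using eq[OF that] by simp
  qed
  have part_size: "n i = (\<Sum>j\<in>J i. card (color_class G f j))" if i: "i \<in> {1..l}" for i
  proof -
    have "{i} \<times> {1..n i} = (\<Union>j\<in>J i. color_class G f j)"
    proof (intro equalityI subsetI)
      fix x assume x: "x \<in> {i} \<times> {1..n i}"
      then have xV: "x \<in> verts G"
        using i by (auto simp: G_def verts_complete_multipartite)
      then have "x \<in> color_class G f (f x)" by (simp add: color_class_def)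
      moreover have "f x \<in> {1..k}" using f xV by (auto simp: proper_coloring_def)
      moreover have "p (f x) = i"
        using p(2)[of x "f x"] \<open>x \<in> color_class G f (f x)\<close> x by auto
      ultimately show "x \<in> (\<Union>j\<in>J i. color_class G f j)" by (auto simp: J_def)
    next
      fix x assume "x \<in> (\<Union>j\<in>J i. color_class G f j)"
      then obtain j where j: "x \<in> color_class G f j" "p j = i" by (auto simp: J_def)
      then have "fst x = i" using p(2) by blast
      then show "x \<in> {i} \<times> {1..n i}"
        using j(1) by (auto simp: color_class_def G_def verts_complete_multipartite)
    qed
    moreover have "finite (color_class G f j)" for j
      by (auto simp: color_class_def G_def verts_complete_multipartite)
    ultimately have "card ({i} \<times> {1..n i}) = (\<Sum>j\<in>J i. card (color_class G f j))"
      by (simp only:) (intro card_UN_disjoint; auto simp: J_def color_class_def)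
    then show ?thesis by simp
  qed
  have "q * card (J i) \<le> n i \<and> n i \<le> Suc q * card (J i)" if "i \<in> {1..l}" for i
    using sum_bounded_below[of "J i" q "\<lambda>j. card (color_class G f j)"]
      sum_bounded_above[of "J i" "\<lambda>j. card (color_class G f j)" "Suc q"] q part_size[OF that]
    by (simp add: J_def mult.commute del: mult_Suc mult_Suc_right)
  moreover have "(\<Sum>i\<in>{1..l}. card (J i)) = k"
    using sum_fun_comp[of "{1..k}" "{1..l}" p "\<lambda>_. 1::nat"] p(1)
    by (simp add: J_def image_subset_iff)
  ultimately show ?thesis
    unfolding balanced_split_def by (intro exI[of _ q] exI[of _ "\<lambda>i. card (J i)"]) blast
qed

lemma equitably_colorable_if_balanced_split:
  assumes "balanced_split {1..l} n k"
  shows "equitably_colorable (complete_multipartite l n) k"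
proof -
  define G where "G = complete_multipartite l n"
  obtain q c where c: "\<And>i. i \<in> {1..l} \<Longrightarrow> q * c i \<le> n i \<and> n i \<le> Suc q * c i"
    and sum_c: "sum c {1..l} = k"
    using assms unfolding balanced_split_def by blast
  have "\<forall>i\<in>{1..l}. \<exists>f. f \<in> {1..n i} \<rightarrow> {..<c i} \<and>
      (\<forall>s\<in>{..<c i}. card {x \<in> {1..n i}. f x = s} \<in> {q, Suc q})"
    using ex_map_balanced_fibres[of "{..<c i}" "{1..n i}" q for i] c by simp
  from bchoice[OF this] obtain F where F: "\<And>i. i \<in> {1..l} \<Longrightarrow> F i \<in> {1..n i} \<rightarrow> {..<c i}"
    "\<And>i s. i \<in> {1..l} \<Longrightarrow> s < c i \<Longrightarrow> card {x \<in> {1..n i}. F i x = s} \<in> {q, Suc q}"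
    by blast
  \<comment> \<open>Pairs of a part and one of its own colors are the natural palette; number them from 1 to \<open>k\<close>.\<close>
  define P where "P = (SIGMA i:{1..l}. {..<c i})"
  have "finite P" "card P = card {1..k}" by (simp_all add: P_def flip: sum_c)
  then obtain b where b: "bij_betw b P {1..k}"
    using finite_same_card_bij[of P "{1..k}"] by auto
  define g where "g = (\<lambda>(i, x). b (i, F i x))"
  have in_P: "(i, F i x) \<in> P" if "(i, x) \<in> verts G" for i x
    using that F(1)[of i] by (auto simp: G_def verts_complete_multipartite P_def)
  have "g \<in> verts G \<rightarrow> {1..k}"
    using in_P b by (auto simp: g_def bij_betw_def)
  moreover have "g x \<noteq> g y" if "{x, y} \<in> edges G" for x y
  proof -
    obtain i s j t where xy: "x = (i, s)" "y = (j, t)" by fastforce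
    have "x \<in> verts G" "y \<in> verts G" "i \<noteq> j"
      using that xy unfolding G_def by (simp_all add: edge_complete_multipartite_iff)
    then have "(i, F i s) \<in> P" "(j, F j t) \<in> P" using in_P xy by auto
    then show ?thesis
      using inj_onD[OF bij_betw_imp_inj_on[OF b]] \<open>i \<noteq> j\<close> xy by (auto simp: g_def)
  qed
  ultimately have "proper_coloring G k g" by (auto simp: proper_coloring_def)
  moreover have size: "card (color_class G g m) \<in> {q, Suc q}" if "m \<in> {1..k}" for m
  proof -
    have "m \<in> b ` P" using b that by (simp add: bij_betw_def)
    then obtain i s where pal: "(i, s) \<in> P" "b (i, s) = m" by auto
    then have i: "i \<in> {1..l}" "s < c i" by (auto simp: P_def)
    have "color_class G g m = {i} \<times> {x \<in> {1..n i}. F i x = s}"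
    proof (intro equalityI subsetI)
      fix v assume v: "v \<in> color_class G g m"
      obtain j x where jx: "v = (j, x)" by fastforce
      have "(j, F j x) \<in> P" "b (j, F j x) = b (i, s)"
        using v pal in_P[of j x] by (auto simp: jx color_class_def g_def)
      then have "(j, F j x) = (i, s)"
        using inj_onD[OF bij_betw_imp_inj_on[OF b]] pal(1) by blast
      then show "v \<in> {i} \<times> {x \<in> {1..n i}. F i x = s}"
        using v by (auto simp: jx color_class_def G_def verts_complete_multipartite)
    next
      fix v assume "v \<in> {i} \<times> {x \<in> {1..n i}. F i x = s}"
      then show "v \<in> color_class G g m"
        using pal i by (auto simp: color_class_def G_def verts_complete_multipartite g_def)
    qed
    then show ?thesis using F(2)[OF i] by (simp add: card_cartesian_product)
  qed
  moreover have "card (color_class G g i) \<le> card (color_class G g j) + 1"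
    if "i \<in> {1..k}" "j \<in> {1..k}" for i j
    using size[OF that(1)] size[OF that(2)] by auto
  ultimately show ?thesis
    unfolding equitably_colorable_def equitable_coloring_def G_def by blast
qed

lemma equitably_colorable_iff_balanced_split:
  assumes "l > 0" "k > 0"
  shows "equitably_colorable (complete_multipartite l n) k \<longleftrightarrow> balanced_split {1..l} n k"
  using assms balanced_split_if_equitably_colorable equitably_colorable_if_balanced_split by blast

section \<open>The equitable chromatic threshold\<close>

theorem theorem2p1:
  fixes l h :: nat and n :: "nat \<Rightarrow> nat"
  assumes "l \<ge> 2"
    and "\<And>i. i \<in> {1..l} \<Longrightarrow> n i > 0"
    and "h = (LEAST q. q > 0 \<and>
          ((\<exists>i \<in> {1..l}. real (n i) / (real q + 1) > of_int \<lfloor>real (n i) / real q\<rfloor>) \<or>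
           (\<exists>i \<in> {1..l}. \<exists>j \<in> {1..l}. i \<noteq> j \<and> \<not> q dvd n i \<and> \<not> q dvd n j)))"
  shows "int (equitable_chromatic_threshold (complete_multipartite l n)) =
         (\<Sum>i = 1..l. \<lceil>real (n i) / real h\<rceil>)"
proof -
  have h_def: "h = (LEAST q. q > 0 \<and> obstructed {1..l} n q)"
    unfolding assms(3) obstructed_def floor_less_divide_Suc_iff ..
  have "obstructed {1..l} n (Suc (n 1))"
    using assms(1,2) by (intro obstructed_Suc_size) auto
  then have h: "h > 0" "obstructed {1..l} n h"
    unfolding h_def using LeastI[of "\<lambda>q. q > 0 \<and> obstructed {1..l} n q" "Suc (n 1)"] by auto
  have below_h: "\<not> obstructed {1..l} n q" if "0 < q" "q < h" for q
    using that not_less_Least unfolding h_def by blast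
  define T where "T = (\<Sum>i=1..l. ceil_div (n i) h)"
  have "1 \<le> ceil_div (n i) h" if "i \<in> {1..l}" for i
    using ceil_div_le_iff[OF h(1), of "n i" 0] assms(2)[OF that] by simp
  then have "(\<Sum>i=1..l. 1) \<le> T"
    unfolding T_def by (intro sum_mono) auto
  then have T: "T \<ge> 2" using assms(1) by simp
  have "equitable_chromatic_threshold (complete_multipartite l n) = T"
    unfolding equitable_chromatic_threshold_def
  proof (rule Least_equality)
    have "equitably_colorable (complete_multipartite l n) k" if "T \<le> k" for k
      using balanced_split_from_unobstructed[of "{1..l}" h n k] below_h h(1) assms(1) that
      by (auto simp: T_def intro: equitably_colorable_if_balanced_split)
    then show "T > 0 \<and> (\<forall>k\<ge>T. equitably_colorable (complete_multipartite l n) k)"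
      using T by auto
  next
    fix t assume t: "t > 0 \<and> (\<forall>k\<ge>t. equitably_colorable (complete_multipartite l n) k)"
    have "\<not> balanced_split {1..l} n (T - 1)"
      using T assms(1,2) h by (intro not_balanced_split_below_obstructed) (auto simp: T_def)
    then have "\<not> equitably_colorable (complete_multipartite l n) (T - 1)"
      using equitably_colorable_iff_balanced_split T assms(1) by simp
    then have "\<not> t \<le> T - 1" using t by blast
    then show "T \<le> t" by simp
  qed
  then show ?thesis
    by (simp add: T_def ceiling_divide_eq_ceil_div[OF h(1)])
qed

end
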